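(* Let $1<R\le 3/2$, let $b=1-R$ (so $-1/2\le b<0$), and let $F_n$, $n\ge 1$, be the Faber polynomials of the (real-symmetric) Joukowski airfoil $K$ with parameter $R$. Then for every $n\ge 1$ all zeros of $F_n$ lie in $[-1,1]$, and $$\lim_{n\to\infty}\mu_n=(U^{-1})_*(\mu_{[-1,1]})\quad\text{weak-*},$$ where $\mu_n$ is the normalized counting measure of the zeros of $F_n$, and where the push-forward measure of $\mu_{[-1,1]}$ by $U^{-1}$ is given explicitly by $$(U^{-1})_*(\mu_{[-1,1]})=\frac1\pi\,\frac{1}{\sqrt{1-x^2}}\left(\frac{1-bx}{1+b^2-2bx}\right)dx,\qquad x\in(-1,1).$$
   Context: Let $J(\zeta)=\frac12(\zeta+1/\zeta)$ and, for $R>1$ and $b=1-R$, let $T(z)=Rz+b$ and $\Psi=J\circ T$. The map $\Psi$ is a conformal map of $\{|z|>1\}\cup\{\infty\}$ onto $\overline{\mathbb C}\setminus K$ with $\Psi(\infty)=\infty$, where $K$ is a compact set called the Joukowski airfoil with parameter $R$ (real case). The Faber polynomials $F_n$ of $K$ are defined, for $|w|$ large, by $$\frac{\Psi'(w)}{\Psi(w)-z}=\sum_{n=0}^\infty\frac{F_n(z)}{w^{n+1}};$$ $F_n$ is a polynomial of degree $n$. If $z_1^{(n)},\dots,z_n^{(n)}$ are its zeros (with multiplicity), then $\mu_n=\frac1n\sum_{j=1}^n\delta_{z_j^{(n)}}$. The function $U$ is $$U(x)=\frac{x-b}{\sqrt{b^2+1-2bx}},\qquad x\in[-1,1],$$ with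 the positive square root; for $-1/2\le b<0$ it is an increasing bijection of $[-1,1]$ onto $[-1,1]$, with inverse $U^{-1}$. The measure $\mu_{[-1,1]}=\frac1\pi\frac{dx}{\sqrt{1-x^2}}$ is the equilibrium measure of $[-1,1]$, and $f_*(\nu)$ denotes the push-forward of the measure $\nu$ by the map $f$. *)

theory Defs
  imports "HOL-Probability.Probability" "HOL-Complex_Analysis.Complex_Analysis"
    "HOL-Computational_Algebra.Polynomial"
begin

definition joukowski :: "complex \<Rightarrow> complex" where
  "joukowski \<zeta> = (\<zeta> + 1 / \<zeta>) / 2"

definition airfoil_map :: "real \<Rightarrow> complex \<Rightarrow> complex" where
  "airfoil_map R w = joukowski (of_real R * w + of_real (1 - R))"

definition joukowski_airfoil :: "real \<Rightarrow> complex set" where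
  "joukowski_airfoil R = - (airfoil_map R ` {w. 1 < norm w})"

text \<open>
  For fixed \<open>z\<close> the expansion is required for all sufficiently large \<open>\<bar>w\<bar>\<close>, with a bound
  that may depend on \<open>z\<close>. This determines the values of every \<open>F n\<close>, hence the
  polynomials; that \<open>F n\<close> has degree \<open>n\<close> is a consequence and is not part of the definition.
\<close>

definition faber_polynomials :: "(complex \<Rightarrow> complex) \<Rightarrow> (nat \<Rightarrow> complex poly) \<Rightarrow> bool" where
  "faber_polynomials \<Psi> F \<longleftrightarrow>
     (\<forall>z. \<forall>\<^sub>F w in at_infinity.
        (\<lambda>n. poly (F n) z / w ^ (n + 1)) sums (deriv \<Psi> w / (\<Psi> w - z)))"

text \<open>
  The measure \<open>(1/n) \<Sum> \<delta>\<^sub>z\<close>, summed over the zeros \<open>z\<close> of \<open>p\<close> repeated according to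
  multiplicity, as a Borel measure on the plane; meant for \<open>p\<close> of degree \<open>n \<ge> 1\<close>.
\<close>

definition zero_counting_measure :: "nat \<Rightarrow> complex poly \<Rightarrow> complex measure" where
  "zero_counting_measure n p =
     distr (point_measure {z. poly p z = 0} (\<lambda>z. ennreal (real (order z p) / real n)))
       borel (\<lambda>z. z)"

text \<open>
  For a sequence of Borel probability measures on the plane converging to a Borel probability
  measure, testing against bounded continuous functions is equivalent to testing against
  continuous functions of compact support.
\<close>

definition weak_star_converges :: "(nat \<Rightarrow> complex measure) \<Rightarrow> complex measure \<Rightarrow> bool" where
  "weak_star_converges M N \<longleftrightarrow>
     (\<forall>f :: complex \<Rightarrow> real. continuous_on UNIV f \<and> bounded (range f) \<longrightarrow>
        (\<lambda>n. \<integral>z. f z \<partial>(M n)) \<longlonglongrightarrow> (\<integral>z. f z \<partial>N))"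

definition airfoil_U :: "real \<Rightarrow> real \<Rightarrow> real" where
  "airfoil_U b x = (x - b) / sqrt (b\<^sup>2 + 1 - 2 * b * x)"

text \<open>
  The underlying space is the interval itself, so that its image under the inverse of
  \<open>airfoil_U b\<close> does not involve values of \<open>inv_into\<close> outside \<open>{-1..1}\<close>.
\<close>

definition equilibrium_measure :: "real measure" where
  "equilibrium_measure =
     density (restrict_space lborel {-1..1}) (\<lambda>x. ennreal (1 / pi * (1 / sqrt (1 - x\<^sup>2))))"

definition airfoil_limit_measure :: "real \<Rightarrow> real measure" where
  "airfoil_limit_measure b =
     distr equilibrium_measure borel (inv_into {-1..1} (airfoil_U b))"

lemma norm_airfoil_affine_gt_1:
  assumes "1 < R" "1 < norm w"
  shows "1 < norm (of_real R * w + of_real (1 - R) :: complex)"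
proof -
  have "1 = R * 1 - (R - 1)" by simp
  also have "\<dots> < R * norm w - (R - 1)" using assms by simp
  also have "\<dots> = norm (of_real R * w) - norm (of_real (1 - R) :: complex)"
    using assms by (simp add: norm_mult del: of_real_diff)
  also have "\<dots> \<le> norm (of_real R * w + of_real (1 - R))"
    using norm_diff_ineq by blast
  finally show ?thesis .
qed

lemma joukowski_eq_iff:
  assumes "s \<noteq> 0" "t \<noteq> 0"
  shows "joukowski s = joukowski t \<longleftrightarrow> s = t \<or> s * t = 1"
proof -
  have "joukowski s - joukowski t = (s - t) * (s * t - 1) / (2 * s * t)"
    using assms by (simp add: joukowski_def field_simps)
  moreover have "joukowski s = joukowski t \<longleftrightarrow> joukowski s - joukowski t = 0" by simp
  ultimately show ?thesis using assms by simp
qed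

lemma airfoil_map_conformal:
  assumes "1 < R"
  shows "airfoil_map R holomorphic_on {w. 1 < norm w}"
    and "bij_betw (airfoil_map R) {w. 1 < norm w} (- joukowski_airfoil R)"
proof -
  have nz: "of_real R * w + of_real (1 - R) \<noteq> (0 :: complex)" if "1 < norm w" for w
    using norm_airfoil_affine_gt_1[OF assms that] by (metis norm_zero not_one_less_zero)
  show "airfoil_map R holomorphic_on {w. 1 < norm w}"
    unfolding airfoil_map_def joukowski_def
    by (intro holomorphic_intros) (use nz in auto)
  have "inj_on (airfoil_map R) {w. 1 < norm w}"
  proof (rule inj_onI, clarsimp)
    fix v w :: complex
    assume v: "1 < norm v" and w: "1 < norm w" and eq: "airfoil_map R v = airfoil_map R w"
    let ?s = "of_real R * v + of_real (1 - R)" and ?t = "of_real R * w + of_real (1 - R)"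
    have "1 < norm ?s * norm ?t"
      using norm_airfoil_affine_gt_1[OF assms v] norm_airfoil_affine_gt_1[OF assms w]
      by (rule less_1_mult)
    then have "?s * ?t \<noteq> 1" by (metis norm_mult norm_one less_irrefl)
    then have "?s = ?t"
      using eq joukowski_eq_iff[OF nz[OF v] nz[OF w]] unfolding airfoil_map_def by blast
    then show "v = w" using assms by simp
  qed
  then show "bij_betw (airfoil_map R) {w. 1 < norm w} (- joukowski_airfoil R)"
    by (simp add: bij_betw_def joukowski_airfoil_def)
qed

text \<open>
  Existence of the Faber polynomials: if \<open>s + t = 2 z\<close> and \<open>s t = 1\<close>, partial fractions give
  \<open>F n z = ((s - b)^n + (t - b)^n - (- b)^n) / R^n\<close>. The symmetric part satisfies a
  two-term recurrence with polynomial coefficients.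
\<close>

fun airfoil_power_sum :: "complex \<Rightarrow> nat \<Rightarrow> complex poly" where
  "airfoil_power_sum b 0 = [:2:]"
| "airfoil_power_sum b (Suc 0) = [:- 2 * b, 2:]"
| "airfoil_power_sum b (Suc (Suc n)) =
     [:- 2 * b, 2:] * airfoil_power_sum b (Suc n) - [:1 + b\<^sup>2, - 2 * b:] * airfoil_power_sum b n"

lemma poly_airfoil_power_sum:
  assumes "s + t = 2 * z" "s * t = 1"
  shows "poly (airfoil_power_sum b n) z = (s - b) ^ n + (t - b) ^ n"
proof (induction b n rule: airfoil_power_sum.induct)
  case (1 b)
  then show ?case by simp
next
  case (2 b)
  then show ?case using assms(1) by (simp add: algebra_simps)
next
  case (3 b n)
  have c: "- 2 * b + 2 * z = (s - b) + (t - b)" "1 + b\<^sup>2 - 2 * b * z = (s - b) * (t - b)"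
    using assms by (simp, algebra)+
  have "poly (airfoil_power_sum b (Suc (Suc n))) z
      = (- 2 * b + 2 * z) * poly (airfoil_power_sum b (Suc n)) z
        - (1 + b\<^sup>2 - 2 * b * z) * poly (airfoil_power_sum b n) z"
    by (simp add: algebra_simps)
  then show ?case unfolding c 3 by (simp add: algebra_simps)
qed

lemma geometric_expansion_at_infinity:
  fixes a :: complex
  assumes "norm a < norm w"
  shows "(\<lambda>n. a ^ n / w ^ (n + 1)) sums (1 / (w - a))"
proof -
  have "0 < norm w" using assms norm_ge_zero[of a] by linarith
  then have w: "w \<noteq> 0" "norm (a / w) < 1" using assms by (simp_all add: norm_divide)
  have "(\<lambda>n. (1 / w) * (a / w) ^ n) sums ((1 / w) * (1 / (1 - a / w)))"
    by (intro sums_mult geometric_sums w)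
  moreover have "(1 / w) * (1 / (1 - a / w)) = 1 / (w - a)"
    using w assms by (auto simp: field_simps)
  ultimately show ?thesis by (simp add: power_divide)
qed

lemma faber_polynomials_airfoil_exist:
  assumes "1 < R"
  shows "\<exists>F. faber_polynomials (airfoil_map R) F"
proof -
  define b r :: complex where "b = of_real (1 - R)" and "r = of_real R"
  define F where "F n = smult (1 / r ^ n) (airfoil_power_sum b n - [:(- b) ^ n:])" for n
  have r: "r \<noteq> 0" using assms by (simp add: r_def)
  have map: "airfoil_map R = (\<lambda>w. (r * w + b + 1 / (r * w + b)) / 2)"
    by (simp add: fun_eq_iff airfoil_map_def joukowski_def r_def b_def)
  have large: "\<forall>\<^sub>F w in at_infinity. norm a < norm (w :: complex)" for a :: complex
    unfolding eventually_at_infinity by (intro exI[of _ "norm a + 1"]) auto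
  have "\<forall>\<^sub>F w in at_infinity. (\<lambda>n. poly (F n) z / w ^ (n + 1))
          sums (deriv (airfoil_map R) w / (airfoil_map R w - z))" for z
  proof -
    define q where "q = csqrt (z\<^sup>2 - 1)"
    define s t where "s = z + q" and "t = z - q"
    have q2: "q\<^sup>2 = z\<^sup>2 - 1" by (simp add: q_def)
    have st: "s + t = 2 * z" "s * t = 1"
      using q2 by (auto simp: s_def t_def algebra_simps power2_eq_square)
    let ?a = "\<lambda>u. (u - b) / r"
    have "\<forall>\<^sub>F w in at_infinity. norm (?a 0) < norm (w :: complex) \<and> norm (?a s) < norm w \<and> norm (?a t) < norm w"
      by (intro eventually_conj large)
    then show ?thesis
    proof (rule eventually_mono, elim conjE)
      fix w :: complex
      assume w: "norm (?a 0) < norm w" "norm (?a s) < norm w" "norm (?a t) < norm w"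
      define T where "T = r * w + b"
      have w_ne: "w \<noteq> ?a u" if "norm (?a u) < norm w" for u using that by auto
      have T_ne: "T \<noteq> u" if "norm (?a u) < norm w" for u
        using w_ne[OF that] r by (auto simp: T_def field_simps)
      note ne = T_ne[OF w(1)] T_ne[OF w(2)] T_ne[OF w(3)]
      have frac: "1 / (w - ?a u) = r / (T - u)" for u
        using r by (simp add: T_def field_simps)
      have val_T: "airfoil_map R w = (T + 1 / T) / 2" by (simp add: map T_def)
      have quad: "T\<^sup>2 + 1 - 2 * z * T = (T - s) * (T - t)"
        unfolding st(1)[symmetric] st(2)[symmetric]
        by (simp add: algebra_simps power2_eq_square)
      have "(airfoil_map R has_field_derivative (r - r / T\<^sup>2) / 2) (at w)"
        unfolding map using ne(1)
        by (auto intro!: derivative_eq_intros simp: T_def power2_eq_square)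
      then have "deriv (airfoil_map R) w = r * (T\<^sup>2 - 1) / (2 * T\<^sup>2)"
        using ne(1) by (simp add: DERIV_imp_deriv field_simps)
      moreover have "airfoil_map R w - z = (T - s) * (T - t) / (2 * T)"
        unfolding quad[symmetric] val_T using ne(1) by (simp add: field_simps power2_eq_square)
      ultimately have "deriv (airfoil_map R) w / (airfoil_map R w - z)
          = r * (T\<^sup>2 - 1) / (T * ((T - s) * (T - t)))"
        using ne by (simp add: power2_eq_square)
      also have "T\<^sup>2 - 1 = T * (T - t) + T * (T - s) - (T - s) * (T - t)"
        using st(2) by (simp add: algebra_simps power2_eq_square)
      also have "r * (T * (T - t) + T * (T - s) - (T - s) * (T - t)) / (T * ((T - s) * (T - t)))
          = r / (T - s) + r / (T - t) - r / (T - 0)"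
        using ne by (simp add: divide_simps) (simp add: algebra_simps)
      finally have val: "deriv (airfoil_map R) w / (airfoil_map R w - z)
          = 1 / (w - ?a s) + 1 / (w - ?a t) - 1 / (w - ?a 0)"
        by (simp only: frac)
      have "poly (F n) z / w ^ (n + 1)
          = ?a s ^ n / w ^ (n + 1) + ?a t ^ n / w ^ (n + 1) - ?a 0 ^ n / w ^ (n + 1)" for n
        unfolding power_divide
        by (simp add: F_def poly_airfoil_power_sum[OF st] add_divide_distrib diff_divide_distrib)
      then show "(\<lambda>n. poly (F n) z / w ^ (n + 1))
          sums (deriv (airfoil_map R) w / (airfoil_map R w - z))"
        unfolding val
        by (simp only:) (intro sums_add sums_diff geometric_expansion_at_infinity w)
    qed
  qed
  then show ?thesis unfolding faber_polynomials_def by blast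
qed

end

theory Submission
  imports Defs
begin

text \<open>
  Write \<open>z = (s + t) / 2\<close> with \<open>s t = 1\<close>. Partial fractions of \<open>\<Psi>' / (\<Psi> - z)\<close> give
  \<open>R ^ n F n z = (s - b) ^ n + (t - b) ^ n - (- b) ^ n\<close>. For \<open>z = x\<close> in \<open>[-1, 1]\<close> the numbers
  \<open>s\<close> and \<open>t\<close> are conjugate and lie on the unit circle, and \<open>U x\<close> is exactly the cosine of the
  argument of \<open>s - b\<close>. With \<open>\<rho> = \<bar>s - b\<bar>\<close> this becomes
  \<open>R ^ n F n x = 2 \<rho> ^ n cos (n arccos (U x)) - (- b) ^ n\<close>, a distorted Chebyshev polynomial with a
  small perturbation (\<open>poly_faber_airfoil_real\<close>).

  The condition \<open>-1/2 \<le> b < 0\<close> says \<open>\<bar>b\<bar> \<le> 1 - \<bar>b\<bar>\<close>, and \<open>1 - \<bar>b\<bar> \<le> \<rho>\<close>; hence the perturbation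
  is always smaller than the amplitude \<open>2 \<rho> ^ n\<close>. At the \<open>n + 1\<close> points where the cosine is \<open>1\<close> or
  \<open>-1\<close> the values of \<open>F n\<close> therefore alternate in sign, and these points enclose \<open>n\<close> distinct zeros
  (\<open>faber_airfoil_zero_between\<close>). As the degree of \<open>F n\<close> is at most \<open>n\<close>, there are no others and
  all are simple (\<open>faber_airfoil_zeros\<close>).

  Let \<open>H = 1 - arccos U / \<pi>\<close>. It is the distribution function of the image of the equilibrium measure
  under the inverse of \<open>U\<close>, and differentiating it yields the explicit density
  (\<open>airfoil_limit_measure_eq_density\<close>). The sign changes occur where \<open>H = j / n\<close>, so exactly one
  zero lies between consecutive \<open>n\<close>-quantiles of the limit measure. The distribution functions of
  the zero counting measures thus differ from \<open>H\<close> by at most \<open>1 / n\<close>, which gives weak convergence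
  (\<open>equidistribution_of_interlaced_points\<close>).
\<close>

section \<open>Values of the Faber polynomials\<close>

text \<open>
  In the variable \<open>u = 1 / w\<close> the difference of the two expansions is a power series that vanishes
  near \<open>0\<close>. Because the defining property of the Faber polynomials only fixes such an expansion,
  this is what turns an expansion into a formula for \<open>F n\<close>.
\<close>

lemma laurent_coeffs_at_infinity_unique:
  fixes a c :: "nat \<Rightarrow> complex"
  assumes a: "\<forall>\<^sub>F w in at_infinity. (\<lambda>n. a n / w ^ (n + 1)) sums S w"
    and c: "\<forall>\<^sub>F w in at_infinity. (\<lambda>n. c n / w ^ (n + 1)) sums S w"
  shows "a = c"
proof (rule ccontr)
  assume "a \<noteq> c"
  then obtain m where m: "a m \<noteq> c m" by auto
  \<comment> \<open>The series in \<open>u\<close> starts with \<open>u\<close> itself, as \<open>1 / w ^ (n + 1)\<close> is \<open>u ^ (n + 1)\<close>; the constant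
    term \<open>0\<close> makes it vanish at \<open>u = 0\<close> too.\<close>
  define d where "d n = (case n of 0 \<Rightarrow> 0 | Suc k \<Rightarrow> a k - c k)" for n
  have "\<forall>\<^sub>F w in at_infinity. (\<lambda>n. (a n - c n) / w ^ (n + 1)) sums 0"
    using a c by eventually_elim (auto dest: sums_diff simp: diff_divide_distrib)
  then obtain B where B: "\<And>w. B \<le> norm w \<Longrightarrow> (\<lambda>n. (a n - c n) / w ^ (n + 1)) sums 0"
    unfolding eventually_at_infinity by blast
  define C where "C = max B 1"
  have C: "B \<le> C" "0 < C" by (simp_all add: C_def)
  define r where "r = 1 / C"
  have r: "0 < r" using C by (simp add: r_def)
  have "(\<lambda>n. d n * (u - 0) ^ n) sums 0" if u: "norm (u - 0) < r" for u
  proof (cases "u = 0")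
    case True
    then have "(\<lambda>n. d n * (u - 0) ^ n) = (\<lambda>n. 0)"
      by (auto simp: d_def split: nat.split)
    then show ?thesis by simp
  next
    case False
    have "C < 1 / norm u"
      using u False C(2) by (simp add: r_def field_simps)
    then have "B \<le> norm (1 / u)" using C(1) by (simp add: norm_divide)
    from B[OF this] have "(\<lambda>n. d (Suc n) * u ^ Suc n) sums 0"
      by (simp add: d_def power_one_over divide_simps)
    then show ?thesis
      by (subst (asm) sums_Suc_iff) (simp add: d_def)
  qed
  moreover have "d (Suc m) \<noteq> 0" using m by (simp add: d_def)
  ultimately obtain s :: real where "0 < s" "\<And>u::complex. u \<in> cball 0 s - {0} \<Longrightarrow> (0::complex) \<noteq> 0"
    using powser_0_nonzero[of r 0 d "\<lambda>_. 0" "Suc m"] r by blast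
  moreover have "complex_of_real s \<in> cball 0 s - {0}" using \<open>0 < s\<close> by simp
  ultimately show False by blast
qed

text \<open>
  In the variable \<open>T = r w + b\<close> one has \<open>\<Psi> - z = (T - s) (T - t) / (2 T)\<close>, and the left-hand side is
  the logarithmic derivative of this product.
\<close>

lemma airfoil_log_derivative:
  fixes r b :: complex
  assumes map: "airfoil_map R = (\<lambda>w. joukowski (r * w + b))"
    and st: "s + t = 2 * z" "s * t = 1" and r: "r \<noteq> 0"
    and T: "T = r * w + b" "T \<noteq> 0" "T \<noteq> s" "T \<noteq> t"
  shows "deriv (airfoil_map R) w / (airfoil_map R w - z) = r / (T - s) + r / (T - t) - r / T"
proof -
  have "(airfoil_map R has_field_derivative (r - r / T\<^sup>2) / 2) (at w)"
    unfolding map joukowski_def using T(2)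
    by (auto intro!: derivative_eq_intros simp: T(1) power2_eq_square)
  then have d: "deriv (airfoil_map R) w = r * (T\<^sup>2 - 1) / (2 * T\<^sup>2)"
    using T(2) by (simp add: DERIV_imp_deriv field_simps)
  have e: "airfoil_map R w - z = (T - s) * (T - t) / (2 * T)"
  proof -
    have "(T - s) * (T - t) = T\<^sup>2 - (s + t) * T + s * t" by algebra
    then show ?thesis unfolding st map joukowski_def T(1)[symmetric]
      using T(2) by (simp add: field_simps power2_eq_square)
  qed
  have "deriv (airfoil_map R) w / (airfoil_map R w - z)
      = r * (T\<^sup>2 - s * t) / (T * ((T - s) * (T - t)))"
    unfolding d e using T(2-4) st(2) by (simp add: power2_eq_square)
  also have "T\<^sup>2 - s * t = T * (T - t) + T * (T - s) - (T - s) * (T - t)" by algebra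
  also have "r * (T * (T - t) + T * (T - s) - (T - s) * (T - t)) / (T * ((T - s) * (T - t)))
      = r / (T - s) + r / (T - t) - r / T"
    using T(2-4) by (simp add: divide_simps) (simp add: algebra_simps)
  finally show ?thesis .
qed

text \<open>
  Each of the three fractions in \<open>airfoil_log_derivative\<close> expands as a geometric series in \<open>1 / w\<close>, with
  ratios proportional to \<open>s - b\<close>, \<open>t - b\<close> and \<open>- b\<close>.
\<close>

lemma faber_polynomial_airfoil:
  assumes R: "0 < R" and F: "faber_polynomials (airfoil_map R) F"
  shows "F n = smult (1 / of_real R ^ n)
    (airfoil_power_sum (of_real (1 - R)) n - [:(- of_real (1 - R)) ^ n:])"
proof -
  define b r :: complex where "b = of_real (1 - R)" and "r = of_real R"
  have r: "r \<noteq> 0" using R by (simp add: r_def)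
  have map: "airfoil_map R = (\<lambda>w. joukowski (r * w + b))"
    by (simp add: fun_eq_iff airfoil_map_def r_def b_def)
  have large: "\<forall>\<^sub>F w in at_infinity. norm a < norm (w :: complex)" for a :: complex
    unfolding eventually_at_infinity by (intro exI[of _ "norm a + 1"]) auto
  have "poly (F n) z = poly (smult (1 / r ^ n) (airfoil_power_sum b n - [:(- b) ^ n:])) z" for z
  proof -
    define s t where "s = z + csqrt (z\<^sup>2 - 1)" and "t = z - csqrt (z\<^sup>2 - 1)"
    have "csqrt (z\<^sup>2 - 1) * csqrt (z\<^sup>2 - 1) = z\<^sup>2 - 1"
      by (metis power2_csqrt power2_eq_square)
    then have st: "s + t = 2 * z" "s * t = 1"
      by (auto simp: s_def t_def algebra_simps power2_eq_square)
    define a where "a u = (u - b) / r" for u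
    have "\<forall>\<^sub>F w in at_infinity. (\<lambda>n. (a s ^ n + a t ^ n - a 0 ^ n) / w ^ (n + 1))
        sums (deriv (airfoil_map R) w / (airfoil_map R w - z))"
      using large[of "a s"] large[of "a t"] large[of "a 0"]
    proof eventually_elim
      case (elim w)
      have ne: "r * w + b \<noteq> u" if "norm (a u) < norm w" for u
        using that r by (auto simp: a_def)
      have frac: "r / (r * w + b - u) = 1 / (w - a u)" for u
        using r by (simp add: a_def divide_simps) (simp add: algebra_simps)
      have "deriv (airfoil_map R) w / (airfoil_map R w - z)
          = r / (r * w + b - s) + r / (r * w + b - t) - r / (r * w + b - 0)"
        using airfoil_log_derivative[OF map st r refl ne[OF elim(3)] ne[OF elim(1)] ne[OF elim(2)]]
        by (simp only: diff_0_right)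
      then have val: "deriv (airfoil_map R) w / (airfoil_map R w - z)
          = 1 / (w - a s) + 1 / (w - a t) - 1 / (w - a 0)"
        by (simp only: frac)
      show ?case unfolding val
        using sums_diff[OF sums_add[OF geometric_expansion_at_infinity[OF elim(1)]
          geometric_expansion_at_infinity[OF elim(2)]] geometric_expansion_at_infinity[OF elim(3)]]
        by (simp only: add_divide_distrib diff_divide_distrib)
    qed
    from laurent_coeffs_at_infinity_unique[OF F[unfolded faber_polynomials_def, rule_format] this]
    have "poly (F n) z = a s ^ n + a t ^ n - a 0 ^ n" by (rule fun_cong)
    then have "poly (F n) z = (s - b) ^ n / r ^ n + (t - b) ^ n / r ^ n - (- b) ^ n / r ^ n"
      by (simp only: a_def power_divide diff_0)
    then show ?thesis
      by (simp add: poly_airfoil_power_sum[OF st] add_divide_distrib diff_divide_distrib)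
  qed
  then show ?thesis unfolding b_def r_def by (intro poly_eq_poly_eq_iff[THEN iffD1] ext)
qed

lemma degree_airfoil_power_sum_le: "degree (airfoil_power_sum b n) \<le> n"
proof (induction b n rule: airfoil_power_sum.induct)
  case (3 b n)
  have "degree ([:- 2 * b, 2:] * airfoil_power_sum b (Suc n)) \<le> 1 + Suc n"
    using 3(1) by (intro degree_mult_le[THEN order_trans] add_mono) auto
  moreover have "degree ([:1 + b\<^sup>2, - 2 * b:] * airfoil_power_sum b n) \<le> 1 + n"
    using 3(2) by (intro degree_mult_le[THEN order_trans] add_mono) auto
  ultimately show ?case by (auto intro!: degree_diff_le simp del: mult_pCons_left)
qed auto

lemma degree_faber_airfoil_le:
  assumes "0 < R" "faber_polynomials (airfoil_map R) F"
  shows "degree (F n) \<le> n"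
  unfolding faber_polynomial_airfoil[OF assms]
  by (intro degree_smult_le[THEN order_trans] degree_diff_le degree_airfoil_power_sum_le) simp

section \<open>The map U and the distribution function of the limit measure\<close>

text \<open>
  The radicand is the squared distance from \<open>b\<close> to the point of the unit circle with real part \<open>x\<close>.
\<close>

lemma airfoil_radicand_pos:
  fixes b x :: real
  assumes "\<bar>b\<bar> < 1" "\<bar>x\<bar> \<le> 1"
  shows "(1 - \<bar>b\<bar>)\<^sup>2 \<le> b\<^sup>2 + 1 - 2 * b * x" "0 < b\<^sup>2 + 1 - 2 * b * x"
proof -
  have "b * x \<le> \<bar>b\<bar>" using assms mult_left_mono[of "\<bar>x\<bar>" 1 "\<bar>b\<bar>"]
    by (metis abs_ge_self abs_ge_zero abs_mult mult.right_neutral order_trans)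
  then show *: "(1 - \<bar>b\<bar>)\<^sup>2 \<le> b\<^sup>2 + 1 - 2 * b * x" by (simp add: power2_diff)
  show "0 < b\<^sup>2 + 1 - 2 * b * x" using * assms by (smt (verit) zero_less_power)
qed

text \<open>
  The radicand \<open>b\<^sup>2 + 1 - 2 b x\<close> exceeds \<open>(x - b)\<^sup>2\<close> by \<open>1 - x\<^sup>2\<close>. Thus \<open>x - b\<close> and
  \<open>sqrt (1 - x\<^sup>2)\<close> are the legs of a right triangle whose hypotenuse is the square root of the radicand.
\<close>

lemma one_minus_airfoil_U_squared:
  assumes "\<bar>b\<bar> < 1" "\<bar>x\<bar> \<le> 1"
  shows "1 - (airfoil_U b x)\<^sup>2 = (1 - x\<^sup>2) / (b\<^sup>2 + 1 - 2 * b * x)"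
  using airfoil_radicand_pos(2)[OF assms]
  by (simp add: airfoil_U_def power_divide divide_simps) (simp add: power2_eq_square algebra_simps)

lemma abs_airfoil_U_le:
  assumes "\<bar>b\<bar> < 1" "\<bar>x\<bar> \<le> 1"
  shows "\<bar>airfoil_U b x\<bar> \<le> 1"
proof -
  have "0 \<le> 1 - (airfoil_U b x)\<^sup>2"
    unfolding one_minus_airfoil_U_squared[OF assms]
    using airfoil_radicand_pos(2)[OF assms] assms(2) by (simp add: abs_square_le_1)
  then show ?thesis by (simp add: abs_square_le_1)
qed

lemma abs_airfoil_U_less:
  assumes "\<bar>b\<bar> < 1" "\<bar>x\<bar> < 1"
  shows "\<bar>airfoil_U b x\<bar> < 1"
proof -
  have "0 < 1 - (airfoil_U b x)\<^sup>2"
    using airfoil_radicand_pos(2)[of b x] assms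
    by (subst one_minus_airfoil_U_squared) (auto simp: abs_square_less_1)
  then show ?thesis by (simp add: abs_square_less_1)
qed

lemma airfoil_U_endpoints:
  assumes "\<bar>b\<bar> < 1"
  shows "airfoil_U b (-1) = -1" "airfoil_U b 1 = 1"
proof -
  have "b\<^sup>2 + 1 - 2 * b * (-1) = (1 + b)\<^sup>2" "b\<^sup>2 + 1 - 2 * b * 1 = (1 - b)\<^sup>2"
    by (simp_all add: power2_eq_square algebra_simps)
  then show "airfoil_U b (-1) = -1" "airfoil_U b 1 = 1"
    using assms unfolding airfoil_U_def by (simp_all add: divide_simps)
qed

lemma continuous_on_airfoil_U:
  assumes "\<bar>b\<bar> < 1"
  shows "continuous_on {-1..1} (airfoil_U b)"
  unfolding airfoil_U_def
  using airfoil_radicand_pos(2)[OF assms] by (intro continuous_intros) force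

lemma airfoil_U_has_derivative:
  assumes "\<bar>b\<bar> < 1" "\<bar>x\<bar> < 1"
  shows "(airfoil_U b has_real_derivative
    (1 - b * x) / ((b\<^sup>2 + 1 - 2 * b * x) * sqrt (b\<^sup>2 + 1 - 2 * b * x))) (at x)"
proof -
  have p: "0 < b\<^sup>2 + 1 - 2 * b * x" using airfoil_radicand_pos(2)[of b x] assms by simp
  define q where "q = sqrt (b\<^sup>2 + 1 - 2 * b * x)"
  have q: "q * q = b\<^sup>2 + 1 - 2 * b * x" "q > 0" using p by (auto simp: q_def)
  have "((\<lambda>x. sqrt (b\<^sup>2 + 1 - 2 * b * x)) has_real_derivative - b / q) (at x)"
    using p by (auto intro!: derivative_eq_intros simp: q_def field_simps)
  moreover have "((\<lambda>x. x - b) has_real_derivative 1) (at x)"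
    by (auto intro!: derivative_eq_intros)
  ultimately have "((\<lambda>x. (x - b) / sqrt (b\<^sup>2 + 1 - 2 * b * x)) has_real_derivative
      (1 * q - (x - b) * (- b / q)) / (q * q)) (at x)"
    using q(2) unfolding q_def by (intro DERIV_divide) auto
  then have "(airfoil_U b has_real_derivative (q + (x - b) * b / q) / (q * q)) (at x)"
    by (simp add: airfoil_U_def[abs_def])
  also have "(q + (x - b) * b / q) / (q * q) = (q * q + (x - b) * b) / (q * q * q)"
    using q(2) by (simp add: field_simps)
  also have "q * q + (x - b) * b = 1 - b * x" by (simp add: q(1) algebra_simps power2_eq_square)
  finally show ?thesis unfolding q(1) by (simp add: q_def)
qed

text \<open>
  The argument is clamped to \<open>[-1, 1]\<close> so that the formula gives the distribution function of the
  limit measure on the whole line.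
\<close>

definition airfoil_cdf :: "real \<Rightarrow> real \<Rightarrow> real" where
  "airfoil_cdf b x = 1 - arccos (airfoil_U b (max (-1) (min 1 x))) / pi"

lemma airfoil_cdf_eq: "\<bar>x\<bar> \<le> 1 \<Longrightarrow> airfoil_cdf b x = 1 - arccos (airfoil_U b x) / pi"
  unfolding airfoil_cdf_def by (subst max.absorb2; subst min.absorb2) auto

lemma airfoil_cdf_left: "\<bar>b\<bar> < 1 \<Longrightarrow> x \<le> -1 \<Longrightarrow> airfoil_cdf b x = 0"
  and airfoil_cdf_right: "\<bar>b\<bar> < 1 \<Longrightarrow> 1 \<le> x \<Longrightarrow> airfoil_cdf b x = 1"
  by (simp_all add: airfoil_cdf_def airfoil_U_endpoints max_def min_def)

text \<open>
  The derivative is \<open>U' / (\<pi> sqrt (1 - U\<^sup>2))\<close>; with \<open>Q = b\<^sup>2 + 1 - 2 b x\<close> one has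
  \<open>U' = (1 - b x) / (Q sqrt Q)\<close> and \<open>1 - U\<^sup>2 = (1 - x\<^sup>2) / Q\<close>, so that the square roots of \<open>Q\<close> cancel.
\<close>

lemma airfoil_cdf_has_derivative:
  assumes "\<bar>b\<bar> < 1" "-1 < x" "x < 1"
  shows "((\<lambda>x. 1 - arccos (airfoil_U b x) / pi) has_real_derivative
    1 / pi * (1 / sqrt (1 - x\<^sup>2)) * ((1 - b * x) / (1 + b\<^sup>2 - 2 * b * x))) (at x)"
proof -
  have x: "\<bar>x\<bar> < 1" using assms by auto
  define Q where "Q = b\<^sup>2 + 1 - 2 * b * x"
  have Q: "0 < Q" "1 + b\<^sup>2 - 2 * b * x = Q"
    using airfoil_radicand_pos(2)[of b x] assms by (auto simp: Q_def)
  have x2: "0 < 1 - x\<^sup>2" using x by (simp add: abs_square_less_1)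
  have U: "\<bar>airfoil_U b x\<bar> < 1" using abs_airfoil_U_less[OF assms(1) x] .
  have s: "sqrt (1 - (airfoil_U b x)\<^sup>2) = sqrt (1 - x\<^sup>2) / sqrt Q"
    using one_minus_airfoil_U_squared[of b x] assms by (simp add: Q_def real_sqrt_divide)
  have "((\<lambda>x. 1 - arccos (airfoil_U b x) / pi) has_real_derivative
     - (inverse (- sqrt (1 - (airfoil_U b x)\<^sup>2)) * ((1 - b * x) / (Q * sqrt Q)) / pi)) (at x)"
    using U airfoil_U_has_derivative[OF assms(1) x]
    by (auto intro!: derivative_eq_intros DERIV_chain2[OF DERIV_arccos] simp: Q_def)
  also have "- (inverse (- sqrt (1 - (airfoil_U b x)\<^sup>2)) * ((1 - b * x) / (Q * sqrt Q)) / pi)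
    = 1 / pi * (1 / sqrt (1 - x\<^sup>2)) * ((1 - b * x) / Q)"
    unfolding s using Q x2 by (simp add: field_simps)
  finally show ?thesis unfolding Q(2) .
qed

lemma continuous_on_airfoil_cdf:
  assumes "\<bar>b\<bar> < 1"
  shows "continuous_on {-1..1} (\<lambda>x. 1 - arccos (airfoil_U b x) / pi)"
  using abs_airfoil_U_le[OF assms]
  by (intro continuous_intros continuous_on_airfoil_U[OF assms]) (auto simp: abs_le_iff)

lemma airfoil_density_pos:
  assumes "\<bar>b\<bar> < 1" "-1 < x" "x < 1"
  shows "0 < 1 / pi * (1 / sqrt (1 - x\<^sup>2)) * ((1 - b * x) / (1 + b\<^sup>2 - 2 * b * x))"
proof -
  have "\<bar>b * x\<bar> < 1" using assms mult_strict_mono'[of "\<bar>b\<bar>" 1 "\<bar>x\<bar>" 1] by (simp add: abs_mult)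
  moreover have "0 < 1 - x\<^sup>2" using assms by (simp add: abs_square_less_1)
  moreover have "0 < 1 + b\<^sup>2 - 2 * b * x"
    using airfoil_radicand_pos(2)[OF assms(1), of x] assms(2,3) by (simp add: abs_le_iff)
  ultimately show ?thesis by (intro mult_pos_pos divide_pos_pos) auto
qed

lemma airfoil_cdf_strict_mono_on:
  assumes "\<bar>b\<bar> < 1" "-1 \<le> x" "x < y" "y \<le> 1"
  shows "airfoil_cdf b x < airfoil_cdf b y"
proof -
  have "1 - arccos (airfoil_U b x) / pi < 1 - arccos (airfoil_U b y) / pi"
  proof (rule DERIV_pos_imp_increasing_open[OF assms(3)])
    fix u assume "x < u" "u < y"
    then show "\<exists>d. ((\<lambda>x. 1 - arccos (airfoil_U b x) / pi) has_real_derivative d) (at u) \<and> 0 < d"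
      using airfoil_cdf_has_derivative[of b u] airfoil_density_pos[of b u] assms by auto
  qed (use assms in \<open>auto intro: continuous_on_subset[OF continuous_on_airfoil_cdf]\<close>)
  then show ?thesis using assms by (simp add: airfoil_cdf_eq)
qed

lemma airfoil_cdf_mono:
  assumes "\<bar>b\<bar> < 1" "x \<le> y"
  shows "airfoil_cdf b x \<le> airfoil_cdf b y"
proof -
  let ?c = "\<lambda>x::real. max (-1) (min 1 x)"
  have "airfoil_cdf b u \<le> airfoil_cdf b v" if "-1 \<le> u" "u \<le> v" "v \<le> 1" for u v
    using airfoil_cdf_strict_mono_on[OF assms(1), of u v] that by (cases "u = v") auto
  then have "airfoil_cdf b (?c x) \<le> airfoil_cdf b (?c y)"
    using assms(2) by auto
  moreover have "airfoil_cdf b (?c x) = airfoil_cdf b x" for x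
    unfolding airfoil_cdf_def by simp
  ultimately show ?thesis by simp
qed

lemma airfoil_cdf_bounds:
  assumes "\<bar>b\<bar> < 1"
  shows "0 \<le> airfoil_cdf b x" "airfoil_cdf b x \<le> 1"
  using airfoil_cdf_mono[OF assms, of "min x (-1)" x] airfoil_cdf_mono[OF assms, of x "max x 1"]
  by (simp_all add: airfoil_cdf_left[OF assms] airfoil_cdf_right[OF assms])

lemma airfoil_cdf_quantile:
  assumes "\<bar>b\<bar> < 1" "0 \<le> y" "y \<le> 1"
  obtains x where "\<bar>x\<bar> \<le> 1" "airfoil_cdf b x = y"
proof -
  have "\<exists>x\<ge>-1. x \<le> 1 \<and> 1 - arccos (airfoil_U b x) / pi = y"
    by (rule IVT') (use assms airfoil_U_endpoints[of b] continuous_on_airfoil_cdf[of b] in auto)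
  then obtain x where x: "-1 \<le> x" "x \<le> 1" "1 - arccos (airfoil_U b x) / pi = y" by auto
  show thesis by (rule that[of x]) (use x in \<open>auto simp: airfoil_cdf_eq\<close>)
qed

lemma airfoil_U_le_iff:
  assumes "\<bar>b\<bar> < 1" "\<bar>x\<bar> \<le> 1" "\<bar>y\<bar> \<le> 1"
  shows "airfoil_U b x \<le> airfoil_U b y \<longleftrightarrow> x \<le> y"
proof -
  have "airfoil_U b x \<le> airfoil_U b y \<longleftrightarrow> airfoil_cdf b x \<le> airfoil_cdf b y"
    using arccos_le_mono[of "airfoil_U b y" "airfoil_U b x"] abs_airfoil_U_le[OF assms(1)] assms
    by (simp add: airfoil_cdf_eq divide_le_cancel)
  also have "\<dots> \<longleftrightarrow> x \<le> y"
    using airfoil_cdf_strict_mono_on[OF assms(1), of y x] airfoil_cdf_mono[OF assms(1), of x y] assms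
    by (smt (verit))
  finally show ?thesis .
qed

lemma bij_betw_airfoil_U:
  assumes "\<bar>b\<bar> < 1"
  shows "bij_betw (airfoil_U b) {-1..1} {-1..1}"
  unfolding bij_betw_def
proof
  show "inj_on (airfoil_U b) {-1..1}"
  proof (rule inj_onI)
    fix x y assume "x \<in> {-1..1}" "y \<in> {-1..1}" "airfoil_U b x = airfoil_U b y"
    then show "x = y"
      using airfoil_U_le_iff[OF assms, of x y] airfoil_U_le_iff[OF assms, of y x] by (auto simp: abs_le_iff)
  qed
  show "airfoil_U b ` {-1..1} = {-1..1}"
  proof (intro equalityI subsetI)
    fix u :: real assume "u \<in> {-1..1}"
    then show "u \<in> airfoil_U b ` {-1..1}"
      using IVT'[of "airfoil_U b" "-1" u 1] airfoil_U_endpoints[OF assms] continuous_on_airfoil_U[OF assms]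
      by force
  qed (use abs_airfoil_U_le[OF assms] in \<open>auto simp: abs_le_iff\<close>)
qed

section \<open>The limit measure\<close>

text \<open>
  The densities considered here are unbounded at the endpoints of \<open>[-1, 1]\<close>, whereas their
  antiderivatives are continuous there; hence differentiability is only asked for in the interior.
\<close>

lemma nn_integral_FTC_open_interval:
  fixes G g :: "real \<Rightarrow> real"
  assumes "a \<le> c" "continuous_on {a..c} G"
    and "\<And>x. a < x \<Longrightarrow> x < c \<Longrightarrow> (G has_real_derivative g x) (at x)"
    and "\<And>x. a < x \<Longrightarrow> x < c \<Longrightarrow> 0 \<le> g x" and [measurable]: "g \<in> borel_measurable borel"
  shows "(\<integral>\<^sup>+x. indicator {a<..<c} x * ennreal (g x) \<partial>lborel) = ennreal (G c - G a)"
proof -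
  have "(g has_integral (G c - G a)) {a..c}"
    using assms by (intro fundamental_theorem_of_calculus_interior)
      (auto simp: has_real_derivative_iff_has_vector_derivative)
  then have "((\<lambda>x. if x \<in> {a<..<c} then g x else 0) has_integral (G c - G a)) UNIV"
    unfolding has_integral_Icc_iff_Ioo by (simp only: has_integral_restrict_UNIV)
  also have "(\<lambda>x. if x \<in> {a<..<c} then g x else 0) = (\<lambda>x. indicator {a<..<c} x * g x)"
    by (auto simp: indicator_def)
  finally have "((\<lambda>x. indicator {a<..<c} x * g x) has_integral (G c - G a)) UNIV" .
  from nn_integral_has_integral_lborel[OF _ _ this] assms(4)
  have "(\<integral>\<^sup>+x. ennreal (indicator {a<..<c} x * g x) \<partial>lborel) = ennreal (G c - G a)"
    by (auto simp: indicator_def)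
  then show ?thesis by (simp add: ennreal_mult'' ennreal_indicator indicator_mult_ennreal)
qed

lemma emeasure_equilibrium_measure_le:
  assumes "-1 \<le> c" "c \<le> 1"
  shows "emeasure equilibrium_measure {u \<in> {-1..1}. u \<le> c} = ennreal (1 - arccos c / pi)"
proof -
  let ?g = "\<lambda>u::real. 1 / pi * (1 / sqrt (1 - u\<^sup>2))"
  have [measurable]: "{u \<in> {-1..1}. u \<le> c} \<in> sets (restrict_space lborel {-1..1::real})"
    by (auto simp: sets_restrict_space_iff intro!: borel_closed closed_Collect_conj closed_Collect_le continuous_intros)
  have [measurable]: "(\<lambda>u. ennreal (?g u)) \<in> borel_measurable (restrict_space lborel {-1..1})"
    by (intro measurable_restrict_space1) simp
  have "emeasure equilibrium_measure {u \<in> {-1..1}. u \<le> c}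
    = (\<integral>\<^sup>+u. ennreal (?g u) * indicator {u \<in> {-1..1}. u \<le> c} u \<partial>restrict_space lborel {-1..1})"
    unfolding equilibrium_measure_def by (rule emeasure_density) measurable
  also have "\<dots> = (\<integral>\<^sup>+u. ennreal (?g u) * indicator {u \<in> {-1..1}. u \<le> c} u * indicator {-1..1} u \<partial>lborel)"
    by (rule nn_integral_restrict_space) simp
  also have "\<dots> = (\<integral>\<^sup>+u. indicator {-1<..<c} u * ennreal (?g u) \<partial>lborel)"
  proof (rule nn_integral_cong_AE)
    show "AE u in lborel. ennreal (?g u) * indicator {u \<in> {-1..1}. u \<le> c} u * indicator {-1..1} u
        = indicator {-1<..<c} u * ennreal (?g u)"
      using AE_lborel_singleton[of "-1::real"] AE_lborel_singleton[of c]
      by eventually_elim (use assms in \<open>auto simp: indicator_def\<close>)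
  qed
  also have "\<dots> = ennreal ((1 - arccos c / pi) - (1 - arccos (-1) / pi))"
  proof (rule nn_integral_FTC_open_interval)
    show "continuous_on {-1..c} (\<lambda>u. 1 - arccos u / pi)"
      using assms by (intro continuous_intros) auto
    fix u assume u: "-1 < u" "u < c"
    then show "((\<lambda>u. 1 - arccos u / pi) has_real_derivative ?g u) (at u)"
      using assms by (auto intro!: derivative_eq_intros simp: inverse_eq_divide)
    show "0 \<le> ?g u" using u assms by (simp add: abs_square_le_1)
  qed (use assms in auto)
  finally show ?thesis by simp
qed

lemma sets_equilibrium_measure [measurable_cong]:
  "sets equilibrium_measure = sets (restrict_space borel {-1..1})"
  unfolding equilibrium_measure_def by (simp add: sets_restrict_space)

lemma space_equilibrium_measure [simp]: "space equilibrium_measure = {-1..1}"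
  unfolding equilibrium_measure_def by (simp add: space_restrict_space)

lemma prob_space_equilibrium_measure: "prob_space equilibrium_measure"
proof
  have "{u \<in> {-1..1}. u \<le> 1} = {-1..1::real}" by auto
  then show "emeasure equilibrium_measure (space equilibrium_measure) = 1"
    using emeasure_equilibrium_measure_le[of 1] by simp
qed

lemma inv_airfoil_U_measurable [measurable]:
  assumes "\<bar>b\<bar> < 1"
  shows "inv_into {-1..1} (airfoil_U b) \<in> borel_measurable equilibrium_measure"
proof -
  have "continuous_on {-1..1} (inv_into {-1..1} (airfoil_U b))"
    using continuous_on_inv[OF continuous_on_airfoil_U[OF assms] compact_Icc,
        of "inv_into {-1..1} (airfoil_U b)"] bij_betw_airfoil_U[OF assms]
    by (auto simp: bij_betw_def)
  then have "inv_into {-1..1} (airfoil_U b) \<in> borel_measurable (restrict_space borel {-1..1})"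
    by (rule borel_measurable_continuous_on_restrict)
  then show ?thesis by (simp cong: measurable_cong_sets add: sets_equilibrium_measure)
qed

lemma real_distribution_airfoil_limit_measure:
  "\<bar>b\<bar> < 1 \<Longrightarrow> real_distribution (airfoil_limit_measure b)"
  unfolding airfoil_limit_measure_def
  by (intro prob_space.real_distribution_distr prob_space_equilibrium_measure inv_airfoil_U_measurable)

text \<open>
  The map \<open>U\<close> is increasing, so that the inverse image of a half-line under its inverse is again an
  initial segment of \<open>[-1, 1]\<close>, ending at \<open>U x\<close> if \<open>x\<close> lies in \<open>[-1, 1]\<close>.
\<close>

lemma emeasure_airfoil_limit_measure:
  assumes b: "\<bar>b\<bar> < 1"
  shows "emeasure (airfoil_limit_measure b) {..x} = ennreal (airfoil_cdf b x)"
proof -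
  let ?V = "inv_into {-1..1} (airfoil_U b)"
  note bij = bij_betw_airfoil_U[OF b]
  have V: "?V u \<in> {-1..1}" "airfoil_U b (?V u) = u" if "u \<in> {-1..1}" for u
    using that bij by (auto simp: bij_betw_def inv_into_into f_inv_into_f)
      (metis inv_into_into atLeastAtMost_iff)+
  have *: "emeasure (airfoil_limit_measure b) {..x}
      = emeasure equilibrium_measure {u \<in> {-1..1}. ?V u \<le> x}"
    unfolding airfoil_limit_measure_def
    by (subst emeasure_distr) (auto intro!: arg_cong2[where f=emeasure] inv_airfoil_U_measurable b)
  show ?thesis
  proof (cases "x < -1")
    case True
    then have none: "{u \<in> {-1..1}. ?V u \<le> x} = {}" using V(1) by force
    show ?thesis unfolding * none using True b by (simp add: airfoil_cdf_left)
  next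
    case False
    define y where "y = min 1 x"
    have y: "\<bar>y\<bar> \<le> 1" using False by (auto simp: y_def)
    have "?V u \<le> x \<longleftrightarrow> u \<le> airfoil_U b y" if u: "u \<in> {-1..1}" for u
    proof -
      have "?V u \<le> x \<longleftrightarrow> ?V u \<le> y" using V(1)[OF u] by (auto simp: y_def)
      also have "\<dots> \<longleftrightarrow> airfoil_U b (?V u) \<le> airfoil_U b y"
        using V(1)[OF u] airfoil_U_le_iff[OF b _ y, of "?V u"] by (auto simp: abs_le_iff)
      finally show ?thesis using V(2)[OF u] by simp
    qed
    then have "{u \<in> {-1..1}. ?V u \<le> x} = {u \<in> {-1..1}. u \<le> airfoil_U b y}" by auto
    moreover have "airfoil_cdf b x = airfoil_cdf b y"
      using False by (simp add: airfoil_cdf_def y_def)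
    ultimately show ?thesis
      unfolding * using emeasure_equilibrium_measure_le[of "airfoil_U b y"] abs_airfoil_U_le[OF b y]
      by (simp add: airfoil_cdf_eq[OF y] abs_le_iff)
  qed
qed

lemma emeasure_airfoil_density:
  assumes b: "\<bar>b\<bar> < 1"
  defines "g \<equiv> \<lambda>x. 1 / pi * (1 / sqrt (1 - x\<^sup>2)) * ((1 - b * x) / (1 + b\<^sup>2 - 2 * b * x))"
  shows "emeasure (density lborel (\<lambda>x. indicator {-1<..<1} x * ennreal (g x))) {..x}
    = ennreal (airfoil_cdf b x)"
proof -
  have g [measurable]: "g \<in> borel_measurable borel" unfolding g_def by measurable
  have "emeasure (density lborel (\<lambda>x. indicator {-1<..<1} x * ennreal (g x))) {..x}
    = (\<integral>\<^sup>+u. indicator {-1<..<1} u * ennreal (g u) * indicator {..x} u \<partial>lborel)"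
    by (rule emeasure_density) measurable
  also have "\<dots> = ennreal (airfoil_cdf b x)"
  proof (cases "x < -1")
    case True
    then have "(\<lambda>u. indicator {-1<..<1} u * ennreal (g u) * indicator {..x} u) = (\<lambda>u. 0)"
      by (auto simp: indicator_def)
    then show ?thesis using True b by (simp add: airfoil_cdf_left)
  next
    case False
    define y where "y = min 1 x"
    have y: "-1 \<le> y" "y \<le> 1" using False by (auto simp: y_def)
    have "(\<integral>\<^sup>+u. indicator {-1<..<1} u * ennreal (g u) * indicator {..x} u \<partial>lborel)
      = (\<integral>\<^sup>+u. indicator {-1<..<y} u * ennreal (g u) \<partial>lborel)"
      by (rule nn_integral_cong_AE, use AE_lborel_singleton[of x] in eventually_elim)
        (auto simp: indicator_def y_def)
    also have "\<dots> = ennreal ((1 - arccos (airfoil_U b y) / pi) - (1 - arccos (airfoil_U b (-1)) / pi))"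
    proof (rule nn_integral_FTC_open_interval)
      show "continuous_on {-1..y} (\<lambda>x. 1 - arccos (airfoil_U b x) / pi)"
        using y by (auto intro: continuous_on_subset[OF continuous_on_airfoil_cdf[OF b]])
      fix u assume u: "-1 < u" "u < y"
      then show "((\<lambda>x. 1 - arccos (airfoil_U b x) / pi) has_real_derivative g u) (at u)"
        unfolding g_def using y by (intro airfoil_cdf_has_derivative b) auto
      show "0 \<le> g u" using airfoil_density_pos[OF b, of u] u y by (simp add: g_def)
    qed (use y in auto)
    also have "\<dots> = ennreal (airfoil_cdf b x)"
      using False y b by (simp add: airfoil_cdf_def y_def airfoil_U_endpoints)
    finally show ?thesis .
  qed
  finally show ?thesis .
qed

lemma cdf_airfoil_limit_measure:
  "\<bar>b\<bar> < 1 \<Longrightarrow> cdf (airfoil_limit_measure b) x = airfoil_cdf b x"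
  by (simp add: cdf_def measure_def emeasure_airfoil_limit_measure airfoil_cdf_bounds)

text \<open>
  A Borel measure on the line of finite mass is determined by its distribution function. Finiteness of
  the measure on the right is read off from its values on half-lines.
\<close>

lemma airfoil_limit_measure_eq_density:
  assumes b: "\<bar>b\<bar> < 1"
  shows "airfoil_limit_measure b = density lborel (\<lambda>x. indicator {-1<..<1} x *
    ennreal (1 / pi * (1 / sqrt (1 - x\<^sup>2)) * ((1 - b * x) / (1 + b\<^sup>2 - 2 * b * x))))"
    (is "_ = ?N")
proof (rule cdf_unique')
  show "finite_borel_measure (airfoil_limit_measure b)"
    using real_distribution_airfoil_limit_measure[OF b] by (rule real_distribution.finite_borel_measure_M)
  have "(\<Union>n. {..real n}) = UNIV" using real_arch_simple by auto
  then have "emeasure ?N UNIV = (SUP n. emeasure ?N {..real n})"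
    by (subst SUP_emeasure_incseq) (auto simp: incseq_def)
  also have "\<dots> \<le> 1"
    unfolding emeasure_airfoil_density[OF b] by (auto intro!: SUP_least simp: airfoil_cdf_bounds[OF b])
  finally have "emeasure ?N UNIV \<noteq> \<infinity>" by (auto simp: top_unique)
  then show "finite_borel_measure ?N"
    by (intro finite_borel_measure.intro finite_measureI finite_borel_measure_axioms.intro) auto
  show "cdf (airfoil_limit_measure b) = cdf ?N"
    unfolding cdf_def measure_def emeasure_airfoil_limit_measure[OF b]
      emeasure_airfoil_density[OF b] ..
qed

section \<open>Zeros of the Faber polynomials\<close>

text \<open>
  This is the geometric meaning of \<open>U\<close>: for a point of the upper unit semicircle with real part \<open>x\<close>,
  the segment from \<open>b\<close> to this point makes the angle \<open>arccos (U x)\<close> with the real axis.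
\<close>

lemma airfoil_polar:
  assumes b: "\<bar>b\<bar> < 1" and x: "\<bar>x\<bar> \<le> 1"
  shows "cis (arccos x) - of_real b = of_real (sqrt (b\<^sup>2 + 1 - 2 * b * x)) * cis (arccos (airfoil_U b x))"
proof (rule complex_eqI)
  have p: "0 < b\<^sup>2 + 1 - 2 * b * x" by (rule airfoil_radicand_pos[OF assms])
  have U: "\<bar>airfoil_U b x\<bar> \<le> 1" by (rule abs_airfoil_U_le[OF assms])
  show "Re (cis (arccos x) - of_real b) = Re (of_real (sqrt (b\<^sup>2 + 1 - 2 * b * x)) * cis (arccos (airfoil_U b x)))"
    using p x U by (simp add: cos_arccos_abs) (simp add: airfoil_U_def)
  show "Im (cis (arccos x) - of_real b) = Im (of_real (sqrt (b\<^sup>2 + 1 - 2 * b * x)) * cis (arccos (airfoil_U b x)))"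
    using p x U by (simp add: sin_arccos_abs one_minus_airfoil_U_squared[OF assms] real_sqrt_divide)
qed

text \<open>
  The two roots \<open>s\<close> and \<open>t\<close> of \<open>\<zeta>\<^sup>2 - 2 x \<zeta> + 1\<close> are conjugate for real \<open>x\<close> in \<open>[-1, 1]\<close>, so their powers add
  up to twice a real part, which de Moivre's formula evaluates.
\<close>

lemma poly_faber_airfoil_real:
  assumes R: "1 < R" "R < 2" and F: "faber_polynomials (airfoil_map R) F" and b: "b = 1 - R"
    and x: "\<bar>x\<bar> \<le> 1"
  shows "poly (F n) (of_real x) = of_real
    ((2 * sqrt (b\<^sup>2 + 1 - 2 * b * x) ^ n * cos (real n * arccos (airfoil_U b x)) - (- b) ^ n) / R ^ n)"
proof -
  have b1: "\<bar>b\<bar> < 1" using R b by auto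
  define \<rho> \<phi> where "\<rho> = sqrt (b\<^sup>2 + 1 - 2 * b * x)" and "\<phi> = arccos (airfoil_U b x)"
  define s where "s = cis (arccos x)"
  have s: "s - of_real b = of_real \<rho> * cis \<phi>"
    unfolding s_def \<rho>_def \<phi>_def by (rule airfoil_polar[OF b1 x])
  then have "cnj (s - of_real b) = cnj (of_real \<rho> * cis \<phi>)" by simp
  then have t: "cnj s - of_real b = of_real \<rho> * cis (- \<phi>)" by (simp add: cis_cnj)
  have "s + cnj s = 2 * of_real x"
    using x by (simp add: s_def complex_add_cnj cos_arccos_abs)
  moreover have "s * cnj s = 1" by (simp add: s_def cis_cnj cis_mult)
  ultimately have "poly (airfoil_power_sum (of_real b) n) (of_real x)
      = (s - of_real b) ^ n + (cnj s - of_real b) ^ n"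
    by (rule poly_airfoil_power_sum)
  also have "\<dots> = of_real (2 * \<rho> ^ n * cos (real n * \<phi>))"
    unfolding s t power_mult_distrib Complex.DeMoivre
    by (simp add: complex_eq_iff flip: of_real_power)
  finally have "poly (F n) (of_real x)
      = 1 / of_real R ^ n * (of_real (2 * \<rho> ^ n * cos (real n * \<phi>)) - (- of_real b) ^ n)"
    using R b by (simp add: faber_polynomial_airfoil[OF _ F])
  then show ?thesis by (simp add: \<rho>_def \<phi>_def)
qed

text \<open>
  At the quantiles \<open>j / n\<close> and \<open>(j + 1) / n\<close> the cosine takes the values \<open>e\<close> and \<open>- e\<close> with
  \<open>\<bar>e\<bar> = 1\<close>, and \<open>(- b) ^ n\<close> is too small to change the sign of the difference. The intermediate value
  theorem gives a zero strictly in between.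
\<close>

lemma faber_airfoil_zero_between:
  fixes b :: real
  assumes b: "- (1 / 2) \<le> b" "b < 0" and n: "j < n"
  obtains x where "\<bar>x\<bar> \<le> 1" "real j / n < airfoil_cdf b x" "airfoil_cdf b x < real (Suc j) / n"
    "2 * sqrt (b\<^sup>2 + 1 - 2 * b * x) ^ n * cos (real n * arccos (airfoil_U b x)) = (- b) ^ n"
proof -
  have b1: "\<bar>b\<bar> < 1" using b by auto
  define \<rho> where "\<rho> x = sqrt (b\<^sup>2 + 1 - 2 * b * x)" for x
  define \<theta> where "\<theta> x = real n * arccos (airfoil_U b x)" for x
  define e :: real where "e = (-1) ^ (n - j)"
  \<comment> \<open>The factor \<open>e\<close> normalises the sign: positive at the left quantile and negative at the right one.\<close>
  define h where "h x = e * (2 * \<rho> x ^ n * cos (\<theta> x) - (- b) ^ n)" for x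
  have n0: "0 < real n" using n by simp
  obtain p where p: "\<bar>p\<bar> \<le> 1" "airfoil_cdf b p = real j / n"
    using airfoil_cdf_quantile[OF b1, of "real j / n"] n by auto
  obtain q where q: "\<bar>q\<bar> \<le> 1" "airfoil_cdf b q = real (Suc j) / n"
    using airfoil_cdf_quantile[OF b1, of "real (Suc j) / n"] n by auto
  have "airfoil_cdf b p < airfoil_cdf b q"
    unfolding p q using n0 by (simp add: divide_strict_right_mono)
  then have pq: "p < q" using airfoil_cdf_mono[OF b1, of q p] by linarith
  have angle: "\<theta> x = real (n - i) * pi"
    if "\<bar>x\<bar> \<le> 1" "airfoil_cdf b x = real i / n" "i \<le> n" for x i
  proof -
    have "arccos (airfoil_U b x) = (1 - real i / n) * pi"
      using that by (simp add: airfoil_cdf_eq field_simps)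
    then show ?thesis using n0 that(3) by (simp add: \<theta>_def field_simps of_nat_diff)
  qed
  have cos_p: "cos (\<theta> p) = e"
    using n by (simp only: angle[OF p] e_def cos_npi less_imp_le)
  have "n - j = Suc (n - Suc j)" using n by simp
  then have cos_q: "cos (\<theta> q) = - e"
    using n by (simp only: angle[OF q] e_def cos_npi Suc_le_eq) simp
  have e2: "e * e = 1" "\<bar>e\<bar> = 1"
    by (simp_all add: e_def power_mult_distrib[symmetric] power_abs)
  have dom: "(- b) ^ n < 2 * \<rho> x ^ n" if "\<bar>x\<bar> \<le> 1" for x
  proof -
    \<comment> \<open>This is where \<open>-1/2 \<le> b\<close> enters.\<close>
    have "- b \<le> 1 - \<bar>b\<bar>" using b by simp
    also have "\<dots> \<le> \<rho> x"
      unfolding \<rho>_def using airfoil_radicand_pos(1)[OF b1 that] b by (intro real_le_rsqrt)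
    finally have "(- b) ^ n \<le> \<rho> x ^ n" using b by (intro power_mono) auto
    moreover have "0 < (- b) ^ n" using b by simp
    ultimately show ?thesis by simp
  qed
  have eb: "\<bar>e * (- b) ^ n\<bar> = (- b) ^ n" using b by (simp add: abs_mult e2 power_abs)
  have "h p = 2 * \<rho> p ^ n * (e * e) - e * (- b) ^ n" "h q = - (2 * \<rho> q ^ n * (e * e)) - e * (- b) ^ n"
    by (simp_all add: h_def cos_p cos_q algebra_simps)
  then have sign: "h q < 0" "0 < h p" using dom[OF p(1)] dom[OF q(1)] eb by (auto simp: e2)
  have "continuous_on {p..q} h"
    unfolding h_def \<rho>_def \<theta>_def using p q abs_airfoil_U_le[OF b1]
    by (intro continuous_intros continuous_on_subset[OF continuous_on_airfoil_U[OF b1]]) (auto simp: abs_le_iff)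
  then obtain x where x: "p \<le> x" "x \<le> q" "h x = 0"
    using IVT2'[of h q 0 p] sign pq by auto
  with sign have "p < x" "x < q" by (auto simp: less_le)
  moreover have "e \<noteq> 0" using e2 by auto
  ultimately show thesis
    using that[of x] x(3) p q airfoil_cdf_strict_mono_on[OF b1, of p x] airfoil_cdf_strict_mono_on[OF b1, of x q]
    by (auto simp: h_def \<rho>_def \<theta>_def)
qed

text \<open>
  Every element of \<open>A\<close> contributes at least \<open>1\<close> to the sum of the orders, which is at most the degree;
  so \<open>card A\<close> bounds this sum from below and from above.
\<close>

lemma simple_zeros_if_degree_le_card:
  fixes p :: "'a :: idom poly"
  assumes "p \<noteq> 0" "degree p \<le> card A" "A \<subseteq> {z. poly p z = 0}"
  shows "{z. poly p z = 0} = A" and "\<And>z. z \<in> A \<Longrightarrow> order z p = 1"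
proof -
  have fin: "finite {z. poly p z = 0}" using assms(1) by (rule poly_roots_finite)
  have "card {z. poly p z = 0} \<le> card A"
    using card_poly_roots_bound[OF assms(1)] assms(2) by linarith
  then have "A = {z. poly p z = 0}" by (rule card_seteq[OF fin assms(3)])
  then show zeros: "{z. poly p z = 0} = A" ..
  fix z assume z: "z \<in> A"
  have ge: "1 \<le> order u p" if "u \<in> A" for u
    using that assms(1,3) order_root[of p u] by (auto simp: Suc_le_eq)
  have "(\<Sum>u\<in>A. order u p) \<le> card A"
    using sum_order_le_degree[OF assms(1)] zeros assms(2) by simp
  then have "(\<Sum>u\<in>A. order u p) = (\<Sum>u\<in>A. 1)"
    using sum_mono[of A "\<lambda>_. 1" "\<lambda>u. order u p"] ge by simp
  then show "order z p = 1"
    using sum_mono_inv[of "\<lambda>_. 1" A "\<lambda>u. order u p" z] ge z fin zeros by metis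
qed

lemma integral_zero_counting_measure:
  fixes f :: "complex \<Rightarrow> real"
  assumes "finite A" "{z. poly p z = 0} = A" "\<And>z. z \<in> A \<Longrightarrow> order z p = 1"
    and "f \<in> borel_measurable borel"
  shows "(\<integral>z. f z \<partial>zero_counting_measure n p) = (\<Sum>z\<in>A. f z) / real n"
proof -
  have "(\<integral>z. f z \<partial>zero_counting_measure n p)
      = (\<integral>z. f z \<partial>point_measure A (\<lambda>z. ennreal (real (order z p) / real n)))"
    unfolding zero_counting_measure_def assms(2)
    by (rule integral_distr) (auto simp: assms(4) measurable_point_measure_eq1)
  then show ?thesis
    using assms(1,3) by (simp add: lebesgue_integral_point_measure_finite sum_divide_distrib)
qed

lemma faber_airfoil_zeros:
  assumes R: "1 < R" "R \<le> 3 / 2" and b: "b = 1 - R" and F: "faber_polynomials (airfoil_map R) F"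
    and n: "1 \<le> n"
  obtains X where "inj_on X {..<n}" "X ` {..<n} \<subseteq> {-1..1}"
    "\<And>j. j < n \<Longrightarrow> real j / n < airfoil_cdf b (X j)"
    "\<And>j. j < n \<Longrightarrow> airfoil_cdf b (X j) < real (Suc j) / n"
    "{z. poly (F n) z = 0} = complex_of_real ` X ` {..<n}"
    "\<And>z. poly (F n) z = 0 \<Longrightarrow> order z (F n) = 1"
proof -
  have b': "- (1 / 2) \<le> b" "b < 0" "\<bar>b\<bar> < 1" using R b by auto
  have "\<exists>x. \<bar>x\<bar> \<le> 1 \<and> real j / n < airfoil_cdf b x \<and> airfoil_cdf b x < real (Suc j) / n \<and>
      2 * sqrt (b\<^sup>2 + 1 - 2 * b * x) ^ n * cos (real n * arccos (airfoil_U b x)) = (- b) ^ n"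
    if "j < n" for j
    using faber_airfoil_zero_between[OF b'(1,2) that] by metis
  then obtain X where X: "\<And>j. j < n \<Longrightarrow> \<bar>X j\<bar> \<le> 1"
    "\<And>j. j < n \<Longrightarrow> real j / n < airfoil_cdf b (X j)"
    "\<And>j. j < n \<Longrightarrow> airfoil_cdf b (X j) < real (Suc j) / n"
    "\<And>j. j < n \<Longrightarrow> 2 * sqrt (b\<^sup>2 + 1 - 2 * b * X j) ^ n * cos (real n * arccos (airfoil_U b (X j))) = (- b) ^ n"
    by metis
  have inj: "inj_on X {..<n}"
  proof (rule linorder_inj_onI)
    fix i j assume ij: "i < j" "i \<in> {..<n}" "j \<in> {..<n}"
    have "real (Suc i) / n \<le> real j / n" using ij by (intro divide_right_mono) auto
    then show "X i \<noteq> X j" using X(3)[of i] X(2)[of j] ij by auto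
  qed auto
  have card: "card (complex_of_real ` X ` {..<n}) = n"
    using inj by (simp add: card_image inj_on_def)
  \<comment> \<open>At the right endpoint the angle is \<open>0\<close>, so that \<open>R ^ n F n 1 = 2 (1 - b) ^ n - (- b) ^ n\<close>.\<close>
  have "poly (F n) (of_real 1) \<noteq> 0"
  proof -
    have "(- b) ^ n < (1 - b) ^ n" using b' n by (intro power_strict_mono) auto
    moreover have "0 < (- b) ^ n" using b' by simp
    moreover have "sqrt (b\<^sup>2 + 1 - 2 * b * 1) = 1 - b"
      using b' by (intro real_sqrt_unique) (auto simp: power2_eq_square algebra_simps)
    ultimately have "0 < 2 * (1 - b) ^ n - (- b) ^ n"
      and "poly (F n) (of_real 1) = of_real ((2 * (1 - b) ^ n - (- b) ^ n) / R ^ n)"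
      using R b' poly_faber_airfoil_real[OF R(1) _ F b, of 1 n]
      by (linarith, simp add: airfoil_U_endpoints)
    then show ?thesis using R by (simp del: of_real_diff of_real_divide of_real_1)
  qed
  then have nz: "F n \<noteq> 0" by auto
  have sub: "complex_of_real ` X ` {..<n} \<subseteq> {z. poly (F n) z = 0}"
    using X(1,4) R by (auto simp: poly_faber_airfoil_real[OF R(1) _ F b])
  have deg: "degree (F n) \<le> card (complex_of_real ` X ` {..<n})"
    unfolding card using R by (intro degree_faber_airfoil_le[OF _ F]) auto
  note zeros = simple_zeros_if_degree_le_card[OF nz deg sub]
  show thesis
  proof (rule that[OF inj _ X(2,3) zeros(1)])
    show "X ` {..<n} \<subseteq> {-1..1}" using X(1) by (auto simp: abs_le_iff)
    show "order z (F n) = 1" if "poly (F n) z = 0" for z using that zeros by blast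
  qed
qed

section \<open>Equidistribution of points interlaced with quantiles\<close>

text \<open>
  Put \<open>y = n H x\<close>. Every index with \<open>X j \<le> x\<close> satisfies \<open>j < y\<close>, and every index with \<open>j + 1 \<le> y\<close> satisfies
  \<open>X j \<le> x\<close>, so the number of such indices lies between \<open>y - 1\<close> and \<open>y + 1\<close>.
\<close>

lemma discrepancy_of_interlaced_points:
  fixes X :: "nat \<Rightarrow> real" and H :: "real \<Rightarrow> real" and n :: nat
  assumes n: "0 < n" and mono: "\<And>x y. x \<le> y \<Longrightarrow> H x \<le> H y" and H: "0 \<le> H x" "H x \<le> 1"
    and lower: "\<And>j. j < n \<Longrightarrow> real j / n < H (X j)"
    and upper: "\<And>j. j < n \<Longrightarrow> H (X j) < real (Suc j) / n"
  shows "\<bar>real (card {j \<in> {..<n}. X j \<le> x}) / n - H x\<bar> \<le> 1 / n"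
proof -
  define y where "y = n * H x"
  have y: "0 \<le> y" "y \<le> n" using H n by (simp_all add: y_def mult_left_le)
  have "{j \<in> {..<n}. X j \<le> x} \<subseteq> {..<nat \<lceil>y\<rceil>}"
  proof clarsimp
    fix j assume "j < n" "X j \<le> x"
    then have "real j / n < H x" using lower mono by (meson less_le_trans)
    then have "real j < y" using n by (simp add: y_def field_simps)
    then show "j < nat \<lceil>y\<rceil>" by linarith
  qed
  then have "card {j \<in> {..<n}. X j \<le> x} \<le> nat \<lceil>y\<rceil>" using card_mono[of "{..<nat \<lceil>y\<rceil>}"] by simp
  then have up: "real (card {j \<in> {..<n}. X j \<le> x}) \<le> y + 1" using y by linarith
  have "{..<nat \<lfloor>y\<rfloor>} \<subseteq> {j \<in> {..<n}. X j \<le> x}"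
  proof clarsimp
    fix j assume "j < nat \<lfloor>y\<rfloor>"
    then have j: "real (Suc j) \<le> y" "j < n" using y by linarith+
    then have "real (Suc j) / n \<le> H x" using n by (simp add: y_def field_simps)
    then have "H (X j) < H x" using upper[OF j(2)] by linarith
    then show "j < n \<and> X j \<le> x" using mono[of x "X j"] j by linarith
  qed
  then have "card {..<nat \<lfloor>y\<rfloor>} \<le> card {j \<in> {..<n}. X j \<le> x}" by (rule card_mono[rotated]) simp
  then have "y - 1 \<le> real (card {j \<in> {..<n}. X j \<le> x})" using y by (simp add: nat_le_iff) linarith
  with up have "\<bar>real (card {j \<in> {..<n}. X j \<le> x}) - y\<bar> \<le> 1" by linarith
  then have "\<bar>(real (card {j \<in> {..<n}. X j \<le> x}) - y) / n\<bar> \<le> 1 / n"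
    using n by (simp add: abs_divide divide_right_mono)
  then show ?thesis using n by (simp add: y_def diff_divide_distrib)
qed

text \<open>
  The averages are integrals against uniform distributions on the point sets. By the discrepancy
  bound, their distribution functions converge everywhere to that of \<open>M\<close>, and this implies
  convergence of integrals of bounded continuous functions.
\<close>

lemma equidistribution_of_interlaced_points:
  fixes X :: "nat \<Rightarrow> nat \<Rightarrow> real" and f :: "real \<Rightarrow> real"
  assumes M: "real_distribution M"
    and inj: "\<And>n. 1 \<le> n \<Longrightarrow> inj_on (X n) {..<n}"
    and lower: "\<And>n j. j < n \<Longrightarrow> real j / n < cdf M (X n j)"
    and upper: "\<And>n j. j < n \<Longrightarrow> cdf M (X n j) < real (Suc j) / n"
    and f: "\<And>x. isCont f x" "\<And>x. \<bar>f x\<bar> \<le> B"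
  shows "(\<lambda>n. (\<Sum>x\<in>X n ` {..<n}. f x) / n) \<longlonglongrightarrow> (\<integral>x. f x \<partial>M)"
proof -
  interpret M: real_distribution M by (rule M)
  \<comment> \<open>The index is shifted by one because there is no uniform distribution on the empty set.\<close>
  define A where "A n = X (Suc n) ` {..<Suc n}" for n
  define N where "N n = distr (measure_pmf (pmf_of_set (A n))) borel (\<lambda>x. x)" for n
  have A: "finite (A n)" "A n \<noteq> {}" "card (A n) = Suc n" for n
    using inj[of "Suc n"] by (auto simp: A_def card_image)
  have N: "real_distribution (N n)" for n
    unfolding N_def by (intro prob_space.real_distribution_distr prob_space_measure_pmf) simp
  have cdf_N: "cdf (N n) x = real (card {j \<in> {..<Suc n}. X (Suc n) j \<le> x}) / real (Suc n)" for n x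
  proof -
    have "cdf (N n) x = measure (measure_pmf (pmf_of_set (A n))) {..x}"
      unfolding cdf_def N_def by (subst measure_distr) auto
    also have "\<dots> = card (A n \<inter> {..x}) / real (Suc n)"
      using A by (simp add: measure_pmf_of_set)
    also have "A n \<inter> {..x} = X (Suc n) ` {j \<in> {..<Suc n}. X (Suc n) j \<le> x}" by (auto simp: A_def)
    also have "card \<dots> = card {j \<in> {..<Suc n}. X (Suc n) j \<le> x}"
      by (intro card_image inj_on_subset[OF inj]) auto
    finally show ?thesis .
  qed
  have "weak_conv_m N M"
    unfolding weak_conv_m_def weak_conv_def
  proof (intro allI impI)
    fix x
    have "\<bar>cdf (N n) x - cdf M x\<bar> \<le> 1 / real (Suc n)" for n
      unfolding cdf_N by (rule discrepancy_of_interlaced_points)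
        (use M.cdf_nondecreasing M.cdf_nonneg M.cdf_bounded_prob lower[of _ "Suc n"] upper[of _ "Suc n"] in auto)
    then show "(\<lambda>n. cdf (N n) x) \<longlonglongrightarrow> cdf M x"
      by (intro LIM_zero_cancel[where l="cdf M x"] Lim_null_comparison[OF _ lim_1_over_n[THEN LIMSEQ_Suc]]) auto
  qed
  then have "(\<lambda>n. \<integral>x. f x \<partial>N n) \<longlonglongrightarrow> (\<integral>x. f x \<partial>M)"
    by (intro weak_conv_imp_integral_bdd_continuous_conv[OF N M] f) (use f(2) in auto)
  moreover have [measurable]: "f \<in> borel_measurable borel"
    using f(1) by (intro borel_measurable_continuous_onI continuous_at_imp_continuous_on) auto
  have "(\<integral>x. f x \<partial>N n) = (\<Sum>x\<in>A n. f x) / real (Suc n)" for n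
    unfolding N_def using A by (subst integral_distr) (auto simp: integral_pmf_of_set)
  ultimately have "(\<lambda>n. (\<Sum>x\<in>X (Suc n) ` {..<Suc n}. f x) / real (Suc n)) \<longlonglongrightarrow> (\<integral>x. f x \<partial>M)"
    by (simp only: A_def)
  then show ?thesis by (subst (asm) filterlim_sequentially_Suc)
qed

section \<open>Zeros of Faber polynomials of Joukowski airfoils\<close>

theorem theorem3p1:
  fixes R b :: real and F :: "nat \<Rightarrow> complex poly"
  assumes "1 < R" and "R \<le> 3 / 2" and "b = 1 - R"
    and "faber_polynomials (airfoil_map R) F"
  shows "(\<forall>n\<ge>1. \<forall>z. poly (F n) z = 0 \<longrightarrow> z \<in> complex_of_real ` {-1..1})
    \<and> weak_star_converges (\<lambda>n. zero_counting_measure n (F n))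
        (distr (airfoil_limit_measure b) borel complex_of_real)
    \<and> airfoil_limit_measure b =
        density lborel (\<lambda>x. indicator {-1<..<1} x *
          ennreal (1 / pi * (1 / sqrt (1 - x\<^sup>2)) * ((1 - b * x) / (1 + b\<^sup>2 - 2 * b * x))))"
proof (intro conjI)
  have b: "\<bar>b\<bar> < 1" using assms by auto
  let ?M = "airfoil_limit_measure b"
  interpret M: real_distribution ?M by (rule real_distribution_airfoil_limit_measure[OF b])
  have "\<exists>X. inj_on X {..<n} \<and> X ` {..<n} \<subseteq> {-1..1} \<and>
      (\<forall>j<n. real j / n < cdf ?M (X j) \<and> cdf ?M (X j) < real (Suc j) / n) \<and>
      {z. poly (F n) z = 0} = complex_of_real ` X ` {..<n} \<and>
      (\<forall>z. poly (F n) z = 0 \<longrightarrow> order z (F n) = 1)" if "1 \<le> n" for n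
    unfolding cdf_airfoil_limit_measure[OF b]
    by (rule faber_airfoil_zeros[OF assms that]) blast
  then obtain X where X: "\<And>n. 1 \<le> n \<Longrightarrow> inj_on (X n) {..<n} \<and> X n ` {..<n} \<subseteq> {-1..1} \<and>
      (\<forall>j<n. real j / n < cdf ?M (X n j) \<and> cdf ?M (X n j) < real (Suc j) / n) \<and>
      {z. poly (F n) z = 0} = complex_of_real ` X n ` {..<n} \<and>
      (\<forall>z. poly (F n) z = 0 \<longrightarrow> order z (F n) = 1)"
    by metis
  show "\<forall>n\<ge>1. \<forall>z. poly (F n) z = 0 \<longrightarrow> z \<in> complex_of_real ` {-1..1}"
    using X by blast
  show "weak_star_converges (\<lambda>n. zero_counting_measure n (F n)) (distr ?M borel complex_of_real)"
    unfolding weak_star_converges_def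
  proof (intro allI impI, elim conjE)
    fix f :: "complex \<Rightarrow> real" assume cont: "continuous_on UNIV f" and "bounded (range f)"
    then obtain B where B: "\<And>z. \<bar>f z\<bar> \<le> B" by (auto simp: bounded_iff)
    have f [measurable]: "f \<in> borel_measurable borel"
      by (rule borel_measurable_continuous_onI[OF cont])
    have "(\<lambda>n. (\<Sum>x\<in>X n ` {..<n}. f (of_real x)) / n) \<longlonglongrightarrow> (\<integral>x. f (of_real x) \<partial>?M)"
    proof (rule equidistribution_of_interlaced_points)
      have "continuous_on UNIV (\<lambda>x. f (complex_of_real x))"
        by (rule continuous_on_compose2[OF cont continuous_on_of_real_id]) simp
      then show "isCont (\<lambda>x. f (complex_of_real x)) x" for x
        by (simp add: continuous_on_eq_continuous_at)
      show "real j / n < cdf ?M (X n j)" "cdf ?M (X n j) < real (Suc j) / n" if "j < n" for n j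
        using X[of n] that by auto
      show "inj_on (X n) {..<n}" if "1 \<le> n" for n using X[OF that] by blast
    qed (rule M.real_distribution_axioms, rule B)
    also have "(\<integral>x. f (of_real x) \<partial>?M) = (\<integral>z. f z \<partial>distr ?M borel complex_of_real)"
      by (rule integral_distr[symmetric]) auto
    finally show "(\<lambda>n. \<integral>z. f z \<partial>zero_counting_measure n (F n))
        \<longlonglongrightarrow> (\<integral>z. f z \<partial>distr ?M borel complex_of_real)"
    proof (rule Lim_transform_eventually)
      show "\<forall>\<^sub>F n in sequentially. (\<Sum>x\<in>X n ` {..<n}. f (of_real x)) / n
          = (\<integral>z. f z \<partial>zero_counting_measure n (F n))"
        using eventually_ge_at_top[of 1]
      proof eventually_elim
        case (elim n)
        note Xn = X[OF elim]
        have "(\<integral>z. f z \<partial>zero_counting_measure n (F n))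
            = (\<Sum>z\<in>complex_of_real ` X n ` {..<n}. f z) / n"
          by (rule integral_zero_counting_measure) (use Xn in auto)
        also have "(\<Sum>z\<in>complex_of_real ` X n ` {..<n}. f z) = (\<Sum>x\<in>X n ` {..<n}. f (of_real x))"
          by (subst sum.reindex) (auto simp: inj_on_def)
        finally show ?case by simp
      qed
    qed
  qed
  show "?M = density lborel (\<lambda>x. indicator {-1<..<1} x *
      ennreal (1 / pi * (1 / sqrt (1 - x\<^sup>2)) * ((1 - b * x) / (1 + b\<^sup>2 - 2 * b * x))))"
    by (rule airfoil_limit_measure_eq_density[OF b])
qed

end
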